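(* Let $\mathsf{JL}$ be a justification logic and $\mathcal{CS}$ a constant specification for $\mathsf{JL}$. If a formula is provable in the tableau system $\mathsf{JL}^{\mathcal T}_{\mathcal{CS}}+(cut)$, then it is also provable in $\mathsf{JL}^{\mathcal T}_{\mathcal{CS}}$.
   Context: Language. Justification terms are built from justification variables and constants using binary $\cdot,+$ and unary $!,\bar?,?$; subterms as usual. Formulas: $A ::= p \mid \bot \mid \neg A \mid A\to A \mid t:A$, $p$ from a countable set $\mathcal P$ of propositional variables. Logics. $\mathsf J$ has axiom schemes: all propositional tautologies; $s:A\to(s+t):A$, $s:A\to(t+s):A$; $s:(A\to B)\to(t:A\to(s\cdot t):B)$. Further schemes: jT: $t:A\to A$; jD: $t:\bot\to\bot$; j4: $t:A\to\,!t:t:A$; jB: $\neg A\to\bar{?}t:\neg t:A$; j5: $\neg t:A\to ?t:\neg t:A$. A justification logic $\mathsf{JL}$ is $\mathsf J$ plus any combination of these; its language contains $\cdot,+$ and those of $!,\bar?,?$ occurring in its axioms. A constant specification $\mathcal{CS}$ for $\mathsf{JL}$ is a downward closed set of formulas $c_{i_n}:\dots:c_{i_1}:A$ ($n\ge1$, constants $c_{i_j}$, $A$ an axiom instance of $\mathsf{JL}$): if $c_{i_n}:c_{i_{n-1}}:\dots:c_{i_1}:A\in\mathcal{CS}$, $n\ge2$, then $c_{i_{n-1}}:\dots:c_{i_1}:A\in\mathcal{CS}$. Subformulas. "$A$ is a $\mathsf{JL}_{\mathcal{CS}}$-subformula of $B$" is the least relation such that: $A=B$; or $B=\neg F$ and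 $A$ is one of $F$; or $B=F\to G$ and $A$ is one of $F$ or of $G$; or $B=t:F$ and $A$ is one of $F$; or $A=t:F$ where $t$ is a subterm of a term occurring in $B$ and $F$ is one of $B$; or $A$ is one of some $c_{i_n}:\dots:c_{i_1}:F\in\mathcal{CS}$; closed under transitivity. $\mathsf{JL}^{\mathcal T}_{\mathcal{CS}}$-tableaux. A tableau for $F$ has root $\neg F$, extended by rule applications whose premises lie on the extended branch. Rules: $(F\neg)$: $\neg\neg A$ / $A$; $(F\to)$: $\neg(A\to B)$ / $A,\neg B$; $(T\to)$: $A\to B$ / $\neg A$ | $B$; $(F+_L)$: $\neg(t+s):A$ / $\neg t:A$; $(F+_R)$: $\neg(t+s):A$ / $\neg s:A$; $(T\cdot)$: from $s:(A\to B)$ and $t:A$ on the branch add $(s\cdot t):B$, provided all three are $\mathsf{JL}_{\mathcal{CS}}$-subformulas of the root; $(PB)$: split into $A$ | $\neg A$, provided $A$ is a $\mathsf{JL}_{\mathcal{CS}}$-subformula of the root. Additionally: with jT, $(T:)$: $t:A$ / $A$; with jD, $(T:_\bot)$: $t:\bot$ / $\bot$; with j4, $(F!)$: $\neg!t:t:A$ / $\neg t:A$; with jB, $(F\bar?)$: $\neg\bar?t:\neg t:A$ / $A$; with j5, $(F?)$: $\neg?t:\neg t:A$ / $t:A$. A branch closes if it contains $A$ and $\neg A$, or $\bot$, or $\neg c:F$ with $c:F\in\mathcal{CS}$; a tableau is closed if all branches close. A formula $F$ is provable in a tableau system if there is a closed tableau of that system with root $\neg F$. The system $\mathsf{JL}^{\mathcal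 T}_{\mathcal{CS}}+(cut)$ additionally has the rule $(cut)$: split any branch into $A$ | $\neg A$ for an arbitrary formula $A$. *)

theory Defs
  imports Main "HOL-Library.Countable"
begin

datatype ('v, 'c) tm =
    JVar 'v
  | JConst 'c
  | App "('v, 'c) tm" "('v, 'c) tm"
  | Plus "('v, 'c) tm" "('v, 'c) tm"
  | Bang "('v, 'c) tm"
  | Qbar "('v, 'c) tm"
  | Quest "('v, 'c) tm"

text \<open>\<open>Just t A\<close> is the formula \<open>t : A\<close>; \<open>Qbar\<close> is the overlined question mark.\<close>

datatype ('v, 'c, 'p) fm =
    Atom 'p
  | Bot
  | Neg "('v, 'c, 'p) fm"
  | Imp "('v, 'c, 'p) fm" "('v, 'c, 'p) fm"
  | Just "('v, 'c) tm" "('v, 'c, 'p) fm"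

text \<open>A justification logic is the basic logic \<open>J\<close> plus a set of additional axiom schemes, and
  is represented by that set (so \<open>{}\<close> is \<open>J\<close> itself).\<close>

datatype scheme = JT | JD | J4 | JB | J5

primrec tm_in :: "scheme set \<Rightarrow> ('v, 'c) tm \<Rightarrow> bool" where
  "tm_in L (JVar x) \<longleftrightarrow> True"
| "tm_in L (JConst c) \<longleftrightarrow> True"
| "tm_in L (App s t) \<longleftrightarrow> tm_in L s \<and> tm_in L t"
| "tm_in L (Plus s t) \<longleftrightarrow> tm_in L s \<and> tm_in L t"
| "tm_in L (Bang t) \<longleftrightarrow> J4 \<in> L \<and> tm_in L t"
| "tm_in L (Qbar t) \<longleftrightarrow> JB \<in> L \<and> tm_in L t"
| "tm_in L (Quest t) \<longleftrightarrow> J5 \<in> L \<and> tm_in L t"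

primrec fm_in :: "scheme set \<Rightarrow> ('v, 'c, 'p) fm \<Rightarrow> bool" where
  "fm_in L (Atom p) \<longleftrightarrow> True"
| "fm_in L Bot \<longleftrightarrow> True"
| "fm_in L (Neg A) \<longleftrightarrow> fm_in L A"
| "fm_in L (Imp A B) \<longleftrightarrow> fm_in L A \<and> fm_in L B"
| "fm_in L (Just t A) \<longleftrightarrow> tm_in L t \<and> fm_in L A"

text \<open>For propositional tautologies, formulas \<open>t : A\<close> count as atoms.\<close>

primrec prop_eval :: "(('v, 'c, 'p) fm \<Rightarrow> bool) \<Rightarrow> ('v, 'c, 'p) fm \<Rightarrow> bool" where
  "prop_eval h (Atom p) \<longleftrightarrow> h (Atom p)"
| "prop_eval h Bot \<longleftrightarrow> False"
| "prop_eval h (Neg A) \<longleftrightarrow> \<not> prop_eval h A"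
| "prop_eval h (Imp A B) \<longleftrightarrow> (prop_eval h A \<longrightarrow> prop_eval h B)"
| "prop_eval h (Just t A) \<longleftrightarrow> h (Just t A)"

definition tautology :: "('v, 'c, 'p) fm \<Rightarrow> bool" where
  "tautology A \<longleftrightarrow> (\<forall>h. prop_eval h A)"

inductive scheme_inst :: "scheme set \<Rightarrow> ('v, 'c, 'p) fm \<Rightarrow> bool" for L where
  taut: "tautology A \<Longrightarrow> scheme_inst L A"
| sumL: "scheme_inst L (Imp (Just s A) (Just (Plus s t) A))"
| sumR: "scheme_inst L (Imp (Just s A) (Just (Plus t s) A))"
| app: "scheme_inst L (Imp (Just s (Imp A B)) (Imp (Just t A) (Just (App s t) B)))"
| jT: "JT \<in> L \<Longrightarrow> scheme_inst L (Imp (Just t A) A)"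
| jD: "JD \<in> L \<Longrightarrow> scheme_inst L (Imp (Just t Bot) Bot)"
| j4: "J4 \<in> L \<Longrightarrow> scheme_inst L (Imp (Just t A) (Just (Bang t) (Just t A)))"
| jB: "JB \<in> L \<Longrightarrow> scheme_inst L (Imp (Neg A) (Just (Qbar t) (Neg (Just t A))))"
| j5: "J5 \<in> L \<Longrightarrow>
    scheme_inst L (Imp (Neg (Just t A)) (Just (Quest t) (Neg (Just t A))))"

definition axiom_inst :: "scheme set \<Rightarrow> ('v, 'c, 'p) fm \<Rightarrow> bool" where
  "axiom_inst L A \<longleftrightarrow> fm_in L A \<and> scheme_inst L A"

text \<open>\<open>const_prefix [c\<^sub>n, \<dots>, c\<^sub>1] A\<close> is \<open>c\<^sub>n : \<dots> : c\<^sub>1 : A\<close>.\<close>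

definition const_prefix :: "'c list \<Rightarrow> ('v, 'c, 'p) fm \<Rightarrow> ('v, 'c, 'p) fm" where
  "const_prefix cs A = foldr (\<lambda>c. Just (JConst c)) cs A"

definition constant_spec :: "scheme set \<Rightarrow> ('v, 'c, 'p) fm set \<Rightarrow> bool" where
  "constant_spec L CS \<longleftrightarrow>
     (\<forall>X\<in>CS. \<exists>cs A. cs \<noteq> [] \<and> axiom_inst L A \<and> X = const_prefix cs A) \<and>
     (\<forall>c cs A. cs \<noteq> [] \<longrightarrow> axiom_inst L A \<longrightarrow>
        const_prefix (c # cs) A \<in> CS \<longrightarrow> const_prefix cs A \<in> CS)"

primrec subterms :: "('v, 'c) tm \<Rightarrow> ('v, 'c) tm set" where
  "subterms (JVar x) = {JVar x}"
| "subterms (JConst c) = {JConst c}"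
| "subterms (App s t) = insert (App s t) (subterms s \<union> subterms t)"
| "subterms (Plus s t) = insert (Plus s t) (subterms s \<union> subterms t)"
| "subterms (Bang t) = insert (Bang t) (subterms t)"
| "subterms (Qbar t) = insert (Qbar t) (subterms t)"
| "subterms (Quest t) = insert (Quest t) (subterms t)"

primrec terms_of :: "('v, 'c, 'p) fm \<Rightarrow> ('v, 'c) tm set" where
  "terms_of (Atom p) = {}"
| "terms_of Bot = {}"
| "terms_of (Neg A) = terms_of A"
| "terms_of (Imp A B) = terms_of A \<union> terms_of B"
| "terms_of (Just t A) = insert t (terms_of A)"

text \<open>\<open>subfm CS A B\<close>: \<open>A\<close> is a subformula of \<open>B\<close> relative to the constant specification \<open>CS\<close>.
  By rule \<open>cs\<close> every subformula of a member of \<open>CS\<close> is a subformula of every formula.\<close>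

inductive subfm ::
  "('v, 'c, 'p) fm set \<Rightarrow> ('v, 'c, 'p) fm \<Rightarrow> ('v, 'c, 'p) fm \<Rightarrow> bool" for CS where
  refl: "subfm CS A A"
| neg: "subfm CS A F \<Longrightarrow> subfm CS A (Neg F)"
| impL: "subfm CS A F \<Longrightarrow> subfm CS A (Imp F G)"
| impR: "subfm CS A G \<Longrightarrow> subfm CS A (Imp F G)"
| just: "subfm CS A F \<Longrightarrow> subfm CS A (Just t F)"
| subterm: "s \<in> terms_of B \<Longrightarrow> t \<in> subterms s \<Longrightarrow> subfm CS F B \<Longrightarrow> subfm CS (Just t F) B"
| cs: "C \<in> CS \<Longrightarrow> subfm CS A C \<Longrightarrow> subfm CS A B"
| trans: "subfm CS A B \<Longrightarrow> subfm CS B C \<Longrightarrow> subfm CS A C"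

text \<open>\<open>tab_rule L CS R \<Theta> [\<Delta>\<^sub>1, \<dots>, \<Delta>\<^sub>k]\<close>: in a tableau with root \<open>R\<close>, some rule allows a branch
  with set of formulas \<open>\<Theta>\<close> to be split into \<open>k\<close> branches, the \<open>i\<close>-th one obtained by appending
  the formulas of \<open>\<Delta>\<^sub>i\<close>.\<close>

inductive tab_rule ::
  "scheme set \<Rightarrow> ('v, 'c, 'p) fm set \<Rightarrow> ('v, 'c, 'p) fm \<Rightarrow> ('v, 'c, 'p) fm set \<Rightarrow>
   ('v, 'c, 'p) fm list list \<Rightarrow> bool"
  for L CS R where
  FNeg: "Neg (Neg A) \<in> \<Theta> \<Longrightarrow> tab_rule L CS R \<Theta> [[A]]"
| FImp: "Neg (Imp A B) \<in> \<Theta> \<Longrightarrow> tab_rule L CS R \<Theta> [[A, Neg B]]"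
| TImp: "Imp A B \<in> \<Theta> \<Longrightarrow> tab_rule L CS R \<Theta> [[Neg A], [B]]"
| FPlusL: "Neg (Just (Plus t s) A) \<in> \<Theta> \<Longrightarrow> tab_rule L CS R \<Theta> [[Neg (Just t A)]]"
| FPlusR: "Neg (Just (Plus t s) A) \<in> \<Theta> \<Longrightarrow> tab_rule L CS R \<Theta> [[Neg (Just s A)]]"
| TApp: "Just s (Imp A B) \<in> \<Theta> \<Longrightarrow> Just t A \<in> \<Theta> \<Longrightarrow>
    subfm CS (Just s (Imp A B)) R \<Longrightarrow> subfm CS (Just t A) R \<Longrightarrow>
    subfm CS (Just (App s t) B) R \<Longrightarrow> tab_rule L CS R \<Theta> [[Just (App s t) B]]"
| PB: "subfm CS A R \<Longrightarrow> tab_rule L CS R \<Theta> [[A], [Neg A]]"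
| TJust: "JT \<in> L \<Longrightarrow> Just t A \<in> \<Theta> \<Longrightarrow> tab_rule L CS R \<Theta> [[A]]"
| TJustBot: "JD \<in> L \<Longrightarrow> Just t Bot \<in> \<Theta> \<Longrightarrow> tab_rule L CS R \<Theta> [[Bot]]"
| FBang: "J4 \<in> L \<Longrightarrow> Neg (Just (Bang t) (Just t A)) \<in> \<Theta> \<Longrightarrow>
    tab_rule L CS R \<Theta> [[Neg (Just t A)]]"
| FQbar: "JB \<in> L \<Longrightarrow> Neg (Just (Qbar t) (Neg (Just t A))) \<in> \<Theta> \<Longrightarrow> tab_rule L CS R \<Theta> [[A]]"
| FQuest: "J5 \<in> L \<Longrightarrow> Neg (Just (Quest t) (Neg (Just t A))) \<in> \<Theta> \<Longrightarrow>
    tab_rule L CS R \<Theta> [[Just t A]]"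

text \<open>Adding cut leaves the subformula provisos of the other rules in place. The cut formula is
  an arbitrary formula of the language of the logic.\<close>

inductive tab_rule_cut ::
  "scheme set \<Rightarrow> ('v, 'c, 'p) fm set \<Rightarrow> ('v, 'c, 'p) fm \<Rightarrow> ('v, 'c, 'p) fm set \<Rightarrow>
   ('v, 'c, 'p) fm list list \<Rightarrow> bool"
  for L CS R where
  base: "tab_rule L CS R \<Theta> \<Delta>s \<Longrightarrow> tab_rule_cut L CS R \<Theta> \<Delta>s"
| cut: "fm_in L A \<Longrightarrow> tab_rule_cut L CS R \<Theta> [[A], [Neg A]]"

text \<open>A tableau is given by the list of its branches, each a list of formulas read from the root.
  \<open>tableau rule R T\<close>: \<open>T\<close> is a tableau with root \<open>R\<close> whose extensions follow \<open>rule\<close>.\<close>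

inductive tableau ::
  "(('v, 'c, 'p) fm \<Rightarrow> ('v, 'c, 'p) fm set \<Rightarrow> ('v, 'c, 'p) fm list list \<Rightarrow> bool) \<Rightarrow>
   ('v, 'c, 'p) fm \<Rightarrow> ('v, 'c, 'p) fm list list \<Rightarrow> bool"
  for rule R where
  root: "tableau rule R [[R]]"
| extend: "tableau rule R (Bs @ [b] @ Bs') \<Longrightarrow> rule R (set b) \<Delta>s \<Longrightarrow>
    tableau rule R (Bs @ map (\<lambda>\<Delta>. b @ \<Delta>) \<Delta>s @ Bs')"

definition closed_branch :: "('v, 'c, 'p) fm set \<Rightarrow> ('v, 'c, 'p) fm list \<Rightarrow> bool" where
  "closed_branch CS b \<longleftrightarrow>
     (\<exists>A. A \<in> set b \<and> Neg A \<in> set b) \<or> Bot \<in> set b \<or>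
     (\<exists>c F. Neg (Just (JConst c) F) \<in> set b \<and> Just (JConst c) F \<in> CS)"

definition closed_tableau :: "('v, 'c, 'p) fm set \<Rightarrow> ('v, 'c, 'p) fm list list \<Rightarrow> bool" where
  "closed_tableau CS T \<longleftrightarrow> (\<forall>b\<in>set T. closed_branch CS b)"

definition provable :: "scheme set \<Rightarrow> ('v, 'c, 'p) fm set \<Rightarrow> ('v, 'c, 'p) fm \<Rightarrow> bool" where
  "provable L CS F \<longleftrightarrow> (\<exists>T. tableau (tab_rule L CS) (Neg F) T \<and> closed_tableau CS T)"

definition provable_cut :: "scheme set \<Rightarrow> ('v, 'c, 'p) fm set \<Rightarrow> ('v, 'c, 'p) fm \<Rightarrow> bool" where
  "provable_cut L CS F \<longleftrightarrow> (\<exists>T. tableau (tab_rule_cut L CS) (Neg F) T \<and> closed_tableau CS T)"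

end

theory Submission imports Defs begin

text \<open>Completeness argument. If \<open>\<not> F\<close> has no closed tableau, Zorn's lemma extends it to a
  maximal non-refutable set \<open>\<Gamma>\<close>, which is saturated under all rules and, by \<open>(PB)\<close>, decides every
  subformula of the root. Outside the subformulas of the root the proviso of \<open>(T\<cdot>)\<close> makes
  application unconstrained, so membership in \<open>\<Gamma>\<close> extends by recursion to a two-valued truth
  predicate on all formulas for which every rule, including cut, is sound. Hence every tableau
  with cut has a branch of true formulas, and such a branch is open.\<close>

section \<open>Refutable sets of formulas\<close>

text \<open>A closed tableau read as a derivation tree over sets, so that \<Theta> may be infinite,
  as Zorn's lemma requires. The list \<open>b\<close> in \<open>closed\<close> picks finitely many
  formulas of \<Theta>, since closure is defined for lists.\<close>

inductive refutable ::
  "scheme set \<Rightarrow> ('v, 'c, 'p) fm set \<Rightarrow> ('v, 'c, 'p) fm \<Rightarrow> ('v, 'c, 'p) fm set \<Rightarrow> bool"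
  for L CS R where
  closed: "closed_branch CS b \<Longrightarrow> set b \<subseteq> \<Theta> \<Longrightarrow> refutable L CS R \<Theta>"
| step: "tab_rule L CS R \<Theta> \<Delta>s \<Longrightarrow> (\<And>\<Delta>. \<Delta> \<in> set \<Delta>s \<Longrightarrow> refutable L CS R (\<Theta> \<union> set \<Delta>)) \<Longrightarrow>
    refutable L CS R \<Theta>"

text \<open>Each rule reads at most two formulas of the branch, and its subformula provisos refer to
  the root \<open>R\<close> only.\<close>

lemma tab_rule_finite_premises:
  assumes "tab_rule L CS R \<Theta> \<Delta>s"
  obtains P where "finite P" "P \<subseteq> \<Theta>" "\<And>\<Theta>'. P \<subseteq> \<Theta>' \<Longrightarrow> tab_rule L CS R \<Theta>' \<Delta>s"
proof -
  have "\<exists>P. finite P \<and> P \<subseteq> \<Theta> \<and> (\<forall>\<Theta>'. P \<subseteq> \<Theta>' \<longrightarrow> tab_rule L CS R \<Theta>' \<Delta>s)"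
    using assms
  proof cases
    case (FNeg A)
    then show ?thesis
      by (intro exI[of _ "{Neg (Neg A)}"]) (auto intro: tab_rule.FNeg)
  next
    case (FImp A B)
    then show ?thesis
      by (intro exI[of _ "{Neg (Imp A B)}"]) (auto intro: tab_rule.FImp)
  next
    case (TImp A B)
    then show ?thesis
      by (intro exI[of _ "{Imp A B}"]) (auto intro: tab_rule.TImp)
  next
    case (FPlusL t s A)
    then show ?thesis
      by (intro exI[of _ "{Neg (Just (Plus t s) A)}"]) (auto intro: tab_rule.FPlusL)
  next
    case (FPlusR t s A)
    then show ?thesis
      by (intro exI[of _ "{Neg (Just (Plus t s) A)}"]) (auto intro: tab_rule.FPlusR)
  next
    case (TApp s A B t)
    then show ?thesis
      by (intro exI[of _ "{Just s (Imp A B), Just t A}"]) (auto intro: tab_rule.TApp)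
  next
    case (PB A)
    then show ?thesis
      by (intro exI[of _ "{}"]) (auto intro: tab_rule.PB)
  next
    case (TJust t A)
    then show ?thesis
      by (intro exI[of _ "{Just t A}"]) (auto intro: tab_rule.TJust)
  next
    case (TJustBot t)
    then show ?thesis
      by (intro exI[of _ "{Just t Bot}"]) (auto intro: tab_rule.TJustBot)
  next
    case (FBang t A)
    then show ?thesis
      by (intro exI[of _ "{Neg (Just (Bang t) (Just t A))}"]) (auto intro: tab_rule.FBang)
  next
    case (FQbar t A)
    then show ?thesis
      by (intro exI[of _ "{Neg (Just (Qbar t) (Neg (Just t A)))}"]) (auto intro: tab_rule.FQbar)
  next
    case (FQuest t A)
    then show ?thesis
      by (intro exI[of _ "{Neg (Just (Quest t) (Neg (Just t A)))}"]) (auto intro: tab_rule.FQuest)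
  qed
  then show thesis using that by blast
qed

lemma tab_rule_mono: "tab_rule L CS R \<Theta> \<Delta>s \<Longrightarrow> \<Theta> \<subseteq> \<Theta>' \<Longrightarrow> tab_rule L CS R \<Theta>' \<Delta>s"
  by (meson tab_rule_finite_premises order_trans)

lemma refutable_mono: "refutable L CS R \<Theta> \<Longrightarrow> \<Theta> \<subseteq> \<Theta>' \<Longrightarrow> refutable L CS R \<Theta>'"
proof (induction arbitrary: \<Theta>' rule: refutable.induct)
  case (closed b \<Theta>)
  then show ?case by (blast intro: refutable.closed)
next
  case (step \<Theta> \<Delta>s)
  show ?case
  proof (rule refutable.step[OF tab_rule_mono[OF step.hyps(1) step.prems]])
    show "refutable L CS R (\<Theta>' \<union> set \<Delta>)" if "\<Delta> \<in> set \<Delta>s" for \<Delta>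
      using step.IH[OF that] step.prems by (meson Un_mono subset_refl)
  qed
qed

text \<open>Compactness: a derivation has finitely many children at each node, and each rule and
  each closure reads finitely many formulas.\<close>

lemma refutable_finite:
  "refutable L CS R \<Theta> \<Longrightarrow> \<exists>\<Theta>0. finite \<Theta>0 \<and> \<Theta>0 \<subseteq> \<Theta> \<and> refutable L CS R \<Theta>0"
proof (induction rule: refutable.induct)
  case (closed b \<Theta>)
  then show ?case
    by (intro exI[of _ "set b"]) (auto intro: refutable.closed)
next
  case (step \<Theta> \<Delta>s)
  obtain P where P: "finite P" "P \<subseteq> \<Theta>" "\<And>\<Theta>'. P \<subseteq> \<Theta>' \<Longrightarrow> tab_rule L CS R \<Theta>' \<Delta>s"
    using tab_rule_finite_premises[OF step.hyps(1)] by blast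
  obtain f where f: "finite (f \<Delta>)" "f \<Delta> \<subseteq> \<Theta> \<union> set \<Delta>" "refutable L CS R (f \<Delta>)"
    if "\<Delta> \<in> set \<Delta>s" for \<Delta>
    using step.IH by metis
  \<comment> \<open>The formulas of \<Delta> are removed so that the rest lies in \<Theta>; they
    come back when the rule appends \<Delta>.\<close>
  let ?\<Theta>0 = "P \<union> (\<Union>\<Delta>\<in>set \<Delta>s. f \<Delta> - set \<Delta>)"
  have "refutable L CS R ?\<Theta>0"
  proof (rule refutable.step)
    show "tab_rule L CS R ?\<Theta>0 \<Delta>s" by (rule P(3)) blast
    show "refutable L CS R (?\<Theta>0 \<union> set \<Delta>)" if "\<Delta> \<in> set \<Delta>s" for \<Delta>
      by (rule refutable_mono[OF f(3)[OF that]]) (use that in blast)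
  qed
  moreover have "finite ?\<Theta>0" using P(1) f(1) by blast
  moreover have "?\<Theta>0 \<subseteq> \<Theta>" using P(2) f(2) by blast
  ultimately show ?case by blast
qed

section \<open>From refutations to closed tableaux\<close>

text \<open>The branches in \<open>bs\<close> are closed from left to right. Each finished block
  joins the left context, hence the induction with \<open>Bs\<close> arbitrary.\<close>

lemma tableau_close_branches:
  assumes "\<And>b Bs Bs'. b \<in> set bs \<Longrightarrow> tableau rule R (Bs @ [b] @ Bs') \<Longrightarrow>
      \<exists>Ts. closed_tableau CS Ts \<and> tableau rule R (Bs @ Ts @ Bs')"
    and "tableau rule R (Bs @ bs @ Bs')"
  shows "\<exists>Ts. closed_tableau CS Ts \<and> tableau rule R (Bs @ Ts @ Bs')"
  using assms
proof (induction bs arbitrary: Bs)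
  case Nil
  then show ?case by (intro exI[of _ "[]"]) (auto simp: closed_tableau_def)
next
  case (Cons b bs)
  have "\<exists>Ts. closed_tableau CS Ts \<and> tableau rule R (Bs @ Ts @ bs @ Bs')"
    using Cons.prems(1)[of b Bs "bs @ Bs'"] Cons.prems(2) by simp
  then obtain Ts where Ts: "closed_tableau CS Ts" "tableau rule R ((Bs @ Ts) @ bs @ Bs')"
    by auto
  have "\<exists>Us. closed_tableau CS Us \<and> tableau rule R ((Bs @ Ts) @ Us @ Bs')"
    by (rule Cons.IH[OF _ Ts(2)]) (use Cons.prems(1) in auto)
  then obtain Us where "closed_tableau CS Us" "tableau rule R ((Bs @ Ts) @ Us @ Bs')"
    by blast
  with Ts(1) show ?case
    by (intro exI[of _ "Ts @ Us"]) (auto simp: closed_tableau_def)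
qed

text \<open>The derivation is replayed on the list \<open>b\<close> inside any surrounding tableau,
  each of its steps becoming one extension of that branch.\<close>

lemma refutable_close_branch:
  assumes "refutable L CS R (set b)" and "tableau (tab_rule L CS) R (Bs @ [b] @ Bs')"
  shows "\<exists>Ts. closed_tableau CS Ts \<and> tableau (tab_rule L CS) R (Bs @ Ts @ Bs')"
  using assms
proof (induction "set b" arbitrary: b Bs Bs' rule: refutable.induct)
  case (closed b')
  then have "closed_branch CS b" unfolding closed_branch_def by blast
  with closed show ?case by (intro exI[of _ "[b]"]) (auto simp: closed_tableau_def)
next
  case (step \<Delta>s)
  show ?case
  proof (rule tableau_close_branches)
    show "tableau (tab_rule L CS) R (Bs @ map (\<lambda>\<Delta>. b @ \<Delta>) \<Delta>s @ Bs')"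
      by (rule tableau.extend[OF step.prems step.hyps(1)])
    show "\<exists>Ts. closed_tableau CS Ts \<and> tableau (tab_rule L CS) R (Cs @ Ts @ Cs')"
      if b': "b' \<in> set (map (\<lambda>\<Delta>. b @ \<Delta>) \<Delta>s)" and T: "tableau (tab_rule L CS) R (Cs @ [b'] @ Cs')"
      for b' Cs Cs'
    proof -
      obtain \<Delta> where "\<Delta> \<in> set \<Delta>s" "b' = b @ \<Delta>" using b' by auto
      then show ?thesis using step.hyps(3)[of \<Delta> b'] T by simp
    qed
  qed
qed

lemma refutable_provable:
  assumes "refutable L CS (Neg F) {Neg F}"
  shows "provable L CS F"
  using refutable_close_branch[of L CS "Neg F" "[Neg F]" "[]" "[]"] assms
  by (auto simp: provable_def intro: tableau.root)

section \<open>Saturated sets\<close>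

definition saturated ::
  "scheme set \<Rightarrow> ('v, 'c, 'p) fm set \<Rightarrow> ('v, 'c, 'p) fm \<Rightarrow> ('v, 'c, 'p) fm set \<Rightarrow> bool" where
  "saturated L CS R \<Gamma> \<longleftrightarrow> (\<forall>b. set b \<subseteq> \<Gamma> \<longrightarrow> \<not> closed_branch CS b) \<and>
     (\<forall>\<Delta>s. tab_rule L CS R \<Gamma> \<Delta>s \<longrightarrow> (\<exists>\<Delta>\<in>set \<Delta>s. set \<Delta> \<subseteq> \<Gamma>))"

text \<open>Non-refutability passes to unions of nonempty chains, because a finite refutable subset
  of the union already lies in one member. A maximal non-refutable set is saturated.\<close>

lemma ex_saturated:
  assumes "\<not> refutable L CS R \<Theta>"
  obtains \<Gamma> where "\<Theta> \<subseteq> \<Gamma>" "saturated L CS R \<Gamma>"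
proof -
  let ?A = "{\<Gamma>. \<Theta> \<subseteq> \<Gamma> \<and> \<not> refutable L CS R \<Gamma>}"
  have "\<exists>M\<in>?A. \<forall>X\<in>?A. M \<subseteq> X \<longrightarrow> X = M"
  proof (rule subset_Zorn_nonempty)
    show "?A \<noteq> {}" using assms by auto
    fix \<C>
    assume ne: "\<C> \<noteq> {}" and chain: "subset.chain ?A \<C>"
    have sub: "\<C> \<subseteq> ?A" using chain unfolding subset.chain_def by (rule conjunct1)
    have "\<not> refutable L CS R (\<Union>\<C>)"
    proof
      assume ref: "refutable L CS R (\<Union>\<C>)"
      obtain \<Theta>0 where *: "finite \<Theta>0" "\<Theta>0 \<subseteq> \<Union>\<C>" "refutable L CS R \<Theta>0"
        using refutable_finite[OF ref] by blast
      obtain X where "X \<in> \<C>" "\<Theta>0 \<subseteq> X"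
        by (rule finite_subset_Union_chain[OF *(1,2) ne chain])
      with sub refutable_mono[OF *(3)] show False by auto
    qed
    moreover have "\<Theta> \<subseteq> \<Union>\<C>" using ne sub by fast
    ultimately show "\<Union>\<C> \<in> ?A" by simp
  qed
  then obtain \<Gamma> where mem: "\<Gamma> \<in> ?A" and max_mem: "\<forall>X\<in>?A. \<Gamma> \<subseteq> X \<longrightarrow> X = \<Gamma>" ..
  from mem have \<Gamma>: "\<Theta> \<subseteq> \<Gamma>" "\<not> refutable L CS R \<Gamma>" by auto
  have max: "X = \<Gamma>" if "\<not> refutable L CS R X" "\<Gamma> \<subseteq> X" for X
    using max_mem that \<Gamma>(1) by auto
  have closed_under: "\<exists>\<Delta>\<in>set \<Delta>s. set \<Delta> \<subseteq> \<Gamma>" if rule: "tab_rule L CS R \<Gamma> \<Delta>s" for \<Delta>s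
  proof -
    \<comment> \<open>If every extension were refutable, the rule would refute \<Gamma> itself.
      Maximality then absorbs the surviving \<Delta>.\<close>
    obtain \<Delta> where \<Delta>: "\<Delta> \<in> set \<Delta>s" "\<not> refutable L CS R (\<Gamma> \<union> set \<Delta>)"
      using \<Gamma>(2) refutable.step[OF rule] by blast
    have "\<Gamma> \<union> set \<Delta> = \<Gamma>" by (rule max[OF \<Delta>(2)]) simp
    with \<Delta>(1) show ?thesis by auto
  qed
  have "saturated L CS R \<Gamma>"
    unfolding saturated_def using \<Gamma>(2) refutable.closed[of CS _ \<Gamma> L R] closed_under by metis
  with \<Gamma>(1) show thesis by (rule that)
qed

section \<open>The truth predicate\<close>

declare conj_cong [fundef_cong]

text \<open>\<Gamma> decides \<open>Just t A\<close> inside \<open>S\<close>. Outside, variables,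
  constants and applications justify nothing, and the other constructors justify just what the
  F-rules demand. \<open>conj_cong\<close> makes the equations on \<open>t\<close> and
  \<open>A\<close> available for termination; formula size counts the terms too, so each call
  decreases.\<close>

function truth ::
  "('v, 'c, 'p) fm set \<Rightarrow> ('v, 'c, 'p) fm set \<Rightarrow> ('v, 'c, 'p) fm \<Rightarrow> bool" where
  "truth S \<Gamma> (Atom p) \<longleftrightarrow> Atom p \<in> \<Gamma>"
| "truth S \<Gamma> Bot \<longleftrightarrow> False"
| "truth S \<Gamma> (Neg A) \<longleftrightarrow> \<not> truth S \<Gamma> A"
| "truth S \<Gamma> (Imp A B) \<longleftrightarrow> (truth S \<Gamma> A \<longrightarrow> truth S \<Gamma> B)"
| "truth S \<Gamma> (Just t A) \<longleftrightarrow>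
     (if Just t A \<in> S then Just t A \<in> \<Gamma>
      else (\<exists>r s. t = Plus r s \<and> (truth S \<Gamma> (Just r A) \<or> truth S \<Gamma> (Just s A))) \<or>
        (\<exists>s B. t = Bang s \<and> A = Just s B \<and> truth S \<Gamma> (Just s B)) \<or>
        (\<exists>s B. t = Qbar s \<and> A = Neg (Just s B) \<and> \<not> truth S \<Gamma> B) \<or>
        (\<exists>s B. t = Quest s \<and> A = Neg (Just s B) \<and> \<not> truth S \<Gamma> (Just s B)))"
  by pat_completeness auto
termination by (relation "measure (\<lambda>(_, _, A). size A)") auto

declare truth.simps(5)[simp del]

lemma truth_Just_mem: "Just t A \<in> S \<Longrightarrow> truth S \<Gamma> (Just t A) \<longleftrightarrow> Just t A \<in> \<Gamma>"
  by (subst truth.simps(5)) simp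

text \<open>For \<open>Bang\<close> and \<open>Quest\<close> the recursive call is rephrased as
  truth of \<open>A\<close>, which makes factivity immediate in these two cases.\<close>

lemma truth_Just_notin:
  "Just (JVar x) A \<notin> S \<Longrightarrow> \<not> truth S \<Gamma> (Just (JVar x) A)"
  "Just (JConst c) A \<notin> S \<Longrightarrow> \<not> truth S \<Gamma> (Just (JConst c) A)"
  "Just (App t s) A \<notin> S \<Longrightarrow> \<not> truth S \<Gamma> (Just (App t s) A)"
  "Just (Plus t s) A \<notin> S \<Longrightarrow>
    truth S \<Gamma> (Just (Plus t s) A) \<longleftrightarrow> truth S \<Gamma> (Just t A) \<or> truth S \<Gamma> (Just s A)"
  "Just (Bang t) A \<notin> S \<Longrightarrow>
    truth S \<Gamma> (Just (Bang t) A) \<longleftrightarrow> (\<exists>B. A = Just t B \<and> truth S \<Gamma> A)"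
  "Just (Qbar t) A \<notin> S \<Longrightarrow>
    truth S \<Gamma> (Just (Qbar t) A) \<longleftrightarrow> (\<exists>B. A = Neg (Just t B) \<and> \<not> truth S \<Gamma> B)"
  "Just (Quest t) A \<notin> S \<Longrightarrow>
    truth S \<Gamma> (Just (Quest t) A) \<longleftrightarrow> (\<exists>B. A = Neg (Just t B) \<and> truth S \<Gamma> A)"
  by (subst truth.simps(5), fastforce)+

section \<open>Closure properties of subformulas\<close>

lemma self_subterm: "t \<in> subterms t"
  by (cases t) auto

lemma subfm_NegD: "subfm CS (Neg A) R \<Longrightarrow> subfm CS A R"
  and subfm_ImpD1: "subfm CS (Imp A B) R \<Longrightarrow> subfm CS A R"
  and subfm_ImpD2: "subfm CS (Imp A B) R \<Longrightarrow> subfm CS B R"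
  and subfm_JustD: "subfm CS (Just t A) R \<Longrightarrow> subfm CS A R"
  by (erule subfm.trans[rotated], intro subfm.intros(1-5))+

text \<open>The subterm clause makes \<open>Just s A\<close> a subformula of \<open>Just t A\<close>
  itself; transitivity does the rest. Thus the summands of a sum stay among the subformulas of the
  root.\<close>

lemma subfm_Just_subterm:
  "subfm CS (Just t A) R \<Longrightarrow> s \<in> subterms t \<Longrightarrow> subfm CS (Just s A) R"
  by (rule subfm.trans[OF subfm.subterm[of t]]) (auto intro: subfm.just subfm.refl)

section \<open>Membership and truth on subformulas of the root\<close>

context
  fixes L :: "scheme set" and CS :: "('v, 'c, 'p) fm set" and R :: "('v, 'c, 'p) fm"
    and \<Gamma> :: "('v, 'c, 'p) fm set"
  assumes sat: "saturated L CS R \<Gamma>"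
begin

abbreviation (input) true :: "('v, 'c, 'p) fm \<Rightarrow> bool" where
  "true \<equiv> truth {A. subfm CS A R} \<Gamma>"

lemma saturatedD: "tab_rule L CS R \<Gamma> \<Delta>s \<Longrightarrow> \<exists>\<Delta>\<in>set \<Delta>s. set \<Delta> \<subseteq> \<Gamma>"
  using sat by (auto simp: saturated_def)

lemma saturated_consistent: "A \<in> \<Gamma> \<Longrightarrow> Neg A \<notin> \<Gamma>"
  using sat unfolding saturated_def closed_branch_def
  by (elim conjE, drule_tac x = "[A, Neg A]" in spec) auto

lemma saturated_Bot: "Bot \<notin> \<Gamma>"
  using sat unfolding saturated_def closed_branch_def
  by (elim conjE, drule_tac x = "[Bot]" in spec) auto

lemma saturated_CS: "Just (JConst c) A \<in> CS \<Longrightarrow> Neg (Just (JConst c) A) \<notin> \<Gamma>"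
  using sat unfolding saturated_def closed_branch_def
  by (elim conjE, drule_tac x = "[Neg (Just (JConst c) A)]" in spec) auto

text \<open>\<open>PB\<close> at \<open>A\<close> puts one of \<open>A\<close> and
  \<open>Neg A\<close> into \<Gamma>, and consistency excludes both. This turns each F-rule into a
  closure property of \<Gamma>.\<close>

lemma saturated_Neg_iff: "subfm CS A R \<Longrightarrow> Neg A \<in> \<Gamma> \<longleftrightarrow> A \<notin> \<Gamma>"
  using saturatedD[OF tab_rule.PB[of CS A R L \<Gamma>]] saturated_consistent[of A] by auto

lemma saturated_Imp_iff:
  assumes "subfm CS (Imp A B) R"
  shows "Imp A B \<in> \<Gamma> \<longleftrightarrow> (A \<in> \<Gamma> \<longrightarrow> B \<in> \<Gamma>)"
proof
  assume "Imp A B \<in> \<Gamma>"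
  then show "A \<in> \<Gamma> \<longrightarrow> B \<in> \<Gamma>"
    using saturatedD[OF tab_rule.TImp[of A B \<Gamma> L CS R]] saturated_consistent[of A] by auto
next
  assume *: "A \<in> \<Gamma> \<longrightarrow> B \<in> \<Gamma>"
  show "Imp A B \<in> \<Gamma>"
  proof (rule ccontr)
    assume "Imp A B \<notin> \<Gamma>"
    then have "Neg (Imp A B) \<in> \<Gamma>" using saturated_Neg_iff[OF assms] by blast
    then have "A \<in> \<Gamma>" "Neg B \<in> \<Gamma>"
      using saturatedD[OF tab_rule.FImp[of A B \<Gamma> L CS R]] by auto
    with * saturated_consistent show False by blast
  qed
qed

text \<open>The truth lemma. Immediate components of subformulas are subformulas, so induction
  applies; for \<open>Just\<close> the agreement is built into \<open>truth\<close>.\<close>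

lemma true_iff_mem: "subfm CS A R \<Longrightarrow> true A \<longleftrightarrow> A \<in> \<Gamma>"
proof (induction A)
  case (Neg A)
  then show ?case using saturated_Neg_iff subfm_NegD by auto
next
  case (Imp A B)
  then show ?case using saturated_Imp_iff subfm_ImpD1 subfm_ImpD2 by (metis truth.simps(4))
qed (auto simp: saturated_Bot truth_Just_mem)

section \<open>Truth under the justification rules\<close>

text \<open>Among the subformulas, a false sum would put its negation into \<Gamma>, and the F-rules
  would then make both summands false. Elsewhere the clause of \<open>truth\<close> for sums gives
  the claim.\<close>

lemma true_Plus:
  assumes "true (Just t A) \<or> true (Just s A)"
  shows "true (Just (Plus t s) A)"
proof (cases "subfm CS (Just (Plus t s) A) R")
  case True
  then have sub: "subfm CS (Just t A) R" "subfm CS (Just s A) R"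
    by (auto simp: self_subterm intro: subfm_Just_subterm[OF True])
  show ?thesis
  proof (rule ccontr)
    assume "\<not> ?thesis"
    then have n: "Neg (Just (Plus t s) A) \<in> \<Gamma>"
      using True true_iff_mem saturated_Neg_iff by blast
    show False
      using saturatedD[OF tab_rule.FPlusL[OF n]] saturatedD[OF tab_rule.FPlusR[OF n]] assms sub
      by (auto simp: saturated_Neg_iff true_iff_mem)
  qed
qed (use assms in \<open>simp add: truth_Just_notin\<close>)

text \<open>The three provisos of the application rule place everything where \<Gamma> decides;
  elsewhere applications are false by definition.\<close>

lemma true_App:
  assumes "true (Just s (Imp A B))" "true (Just t A)"
    and "subfm CS (Just s (Imp A B)) R" "subfm CS (Just t A) R" "subfm CS (Just (App s t) B) R"
  shows "true (Just (App s t) B)"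
  using saturatedD[OF tab_rule.TApp[of s A B \<Gamma> t CS R L]] assms by (auto simp: true_iff_mem)

lemma true_Bang:
  assumes "J4 \<in> L" "true (Just t A)"
  shows "true (Just (Bang t) (Just t A))"
proof (cases "subfm CS (Just (Bang t) (Just t A)) R")
  case True
  then show ?thesis
    using saturatedD[OF tab_rule.FBang[of L t A \<Gamma> CS R]] assms subfm_JustD[OF True]
    by (auto simp: true_iff_mem saturated_Neg_iff dest: saturated_consistent)
qed (use assms in \<open>simp add: truth_Just_notin\<close>)

lemma true_Qbar:
  assumes "JB \<in> L" "\<not> true A"
  shows "true (Just (Qbar t) (Neg (Just t A)))"
proof (cases "subfm CS (Just (Qbar t) (Neg (Just t A))) R")
  case True
  then have "subfm CS A R" by (blast dest: subfm_JustD subfm_NegD)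
  then show ?thesis
    using saturatedD[OF tab_rule.FQbar[of L t A \<Gamma> CS R]] assms True
      saturated_Neg_iff[OF True] by (auto simp: true_iff_mem)
qed (use assms in \<open>simp add: truth_Just_notin\<close>)

lemma true_Quest:
  assumes "J5 \<in> L" "\<not> true (Just t A)"
  shows "true (Just (Quest t) (Neg (Just t A)))"
proof (cases "subfm CS (Just (Quest t) (Neg (Just t A))) R")
  case True
  then have "subfm CS (Just t A) R" by (blast dest: subfm_JustD subfm_NegD)
  then show ?thesis
    using saturatedD[OF tab_rule.FQuest[of L t A \<Gamma> CS R]] assms True
      saturated_Neg_iff[OF True] by (auto simp: true_iff_mem)
qed (use assms in \<open>simp add: truth_Just_notin\<close>)

lemma true_Just_mem:
  assumes "JT \<in> L" "subfm CS (Just t A) R" "true (Just t A)"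
  shows "true A"
  using saturatedD[OF tab_rule.TJust[of L t A \<Gamma> CS R]] assms subfm_JustD[OF assms(2)]
  by (auto simp: true_iff_mem)

text \<open>The rule for \<open>JT\<close> carries no subformula proviso, so formulas beyond the
  reach of \<Gamma> must be covered too: there the claim follows by induction on the term.\<close>

lemma true_JustD:
  assumes "JT \<in> L"
  shows "true (Just t A) \<Longrightarrow> true A"
proof (induction t arbitrary: A)
  case (JVar x)
  show ?case
    using true_Just_mem[OF assms, of "JVar x" A] JVar.prems
    by (cases "subfm CS (Just (JVar x) A) R") (auto simp: truth_Just_notin)
next
  case (JConst c)
  show ?case
    using true_Just_mem[OF assms, of "JConst c" A] JConst.prems
    by (cases "subfm CS (Just (JConst c) A) R") (auto simp: truth_Just_notin)
next
  case (App t s)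
  show ?case
    using true_Just_mem[OF assms, of "App t s" A] App.prems
    by (cases "subfm CS (Just (App t s) A) R") (auto simp: truth_Just_notin)
next
  case (Plus t s)
  show ?case
  proof (cases "subfm CS (Just (Plus t s) A) R")
    case True
    then show ?thesis using true_Just_mem[OF assms] Plus.prems by blast
  next
    case False
    with Plus.prems have "true (Just t A) \<or> true (Just s A)" by (simp add: truth_Just_notin)
    with Plus.IH show ?thesis by blast
  qed
next
  case (Bang t)
  show ?case
    using true_Just_mem[OF assms, of "Bang t" A] Bang.prems
    by (cases "subfm CS (Just (Bang t) A) R") (auto simp: truth_Just_notin)
next
  case (Qbar t)
  show ?case
  proof (cases "subfm CS (Just (Qbar t) A) R")
    case True
    then show ?thesis using true_Just_mem[OF assms] Qbar.prems by blast
  next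
    case False
    with Qbar.prems obtain B where "A = Neg (Just t B)" "\<not> true B"
      by (auto simp: truth_Just_notin)
    \<comment> \<open>Contraposition: were \<open>Just t B\<close> true, the hypothesis for
      \<open>t\<close> would make \<open>B\<close> true. This is why \<open>A\<close> is arbitrary
      in the induction.\<close>
    with Qbar.IH[of B] show ?thesis by auto
  qed
next
  case (Quest t)
  show ?case
    using true_Just_mem[OF assms, of "Quest t" A] Quest.prems
    by (cases "subfm CS (Just (Quest t) A) R") (auto simp: truth_Just_notin)
qed

text \<open>Among the subformulas, the rule for \<open>JD\<close> would put \<open>Bot\<close> into
  \<Gamma>. Elsewhere only a sum could justify \<open>Bot\<close>, which the induction excludes:
  \<open>Bang\<close>, \<open>Qbar\<close> and \<open>Quest\<close> need a formula of another
  shape.\<close>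

lemma true_Just_Bot:
  assumes "JD \<in> L"
  shows "\<not> true (Just t Bot)"
proof -
  have mem: "\<not> true (Just t Bot)" if "subfm CS (Just t Bot) R" for t
    using saturatedD[OF tab_rule.TJustBot[OF assms, of t \<Gamma> CS R]] saturated_Bot that
    by (auto simp: truth_Just_mem)
  show ?thesis
  proof (induction t)
    case (JVar x)
    with mem[of "JVar x"] show ?case
      by (cases "subfm CS (Just (JVar x) Bot) R") (simp_all add: truth_Just_notin)
  next
    case (JConst c)
    with mem[of "JConst c"] show ?case
      by (cases "subfm CS (Just (JConst c) Bot) R") (simp_all add: truth_Just_notin)
  next
    case (App t s)
    with mem[of "App t s"] show ?case
      by (cases "subfm CS (Just (App t s) Bot) R") (simp_all add: truth_Just_notin)
  next
    case (Plus t s)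
    with mem[of "Plus t s"] show ?case
      by (cases "subfm CS (Just (Plus t s) Bot) R") (simp_all add: truth_Just_notin)
  next
    case (Bang t)
    with mem[of "Bang t"] show ?case
      by (cases "subfm CS (Just (Bang t) Bot) R") (simp_all add: truth_Just_notin)
  next
    case (Qbar t)
    with mem[of "Qbar t"] show ?case
      by (cases "subfm CS (Just (Qbar t) Bot) R") (simp_all add: truth_Just_notin)
  next
    case (Quest t)
    with mem[of "Quest t"] show ?case
      by (cases "subfm CS (Just (Quest t) Bot) R") (simp_all add: truth_Just_notin)
  qed
qed

section \<open>Soundness of tableaux with cut\<close>

text \<open>Cut is sound because \<open>truth\<close> is total and two-valued on all formulas, not
  only on subformulas of the root.\<close>

lemma tab_rule_cut_sound:
  assumes "tab_rule_cut L CS R \<Theta> \<Delta>s" and \<Theta>: "\<And>A. A \<in> \<Theta> \<Longrightarrow> true A"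
  shows "\<exists>\<Delta>\<in>set \<Delta>s. \<forall>A\<in>set \<Delta>. true A"
  using assms(1)
proof cases
  case base
  then show ?thesis
  proof cases
    case (FNeg A)
    then show ?thesis using \<Theta>[OF FNeg(2)] by simp
  next
    case (FImp A B)
    then show ?thesis using \<Theta>[OF FImp(2)] by simp
  next
    case (TImp A B)
    then show ?thesis using \<Theta>[OF TImp(2)] by auto
  next
    case (FPlusL t s A)
    then show ?thesis using \<Theta>[OF FPlusL(2)] true_Plus by auto
  next
    case (FPlusR t s A)
    then show ?thesis using \<Theta>[OF FPlusR(2)] true_Plus by auto
  next
    case (TApp s A B t)
    then show ?thesis using \<Theta>[OF TApp(2)] \<Theta>[OF TApp(3)] true_App by auto
  next
    case (TJust t A)
    then show ?thesis using \<Theta>[OF TJust(3)] true_JustD by auto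
  next
    case (TJustBot t)
    then show ?thesis using \<Theta>[OF TJustBot(3)] true_Just_Bot by blast
  next
    case (FBang t A)
    then show ?thesis using \<Theta>[OF FBang(3)] true_Bang by auto
  next
    case (FQbar t A)
    then show ?thesis using \<Theta>[OF FQbar(3)] true_Qbar by auto
  next
    case (FQuest t A)
    then show ?thesis using \<Theta>[OF FQuest(3)] true_Quest by auto
  qed auto
qed auto

lemma tableau_cut_true_branch:
  assumes "tableau (tab_rule_cut L CS) R T" and "true R"
  shows "\<exists>b\<in>set T. \<forall>A\<in>set b. true A"
  using assms(1)
proof (induction rule: tableau.induct)
  case root
  then show ?case using assms(2) by simp
next
  case (extend Bs b Bs' \<Delta>s)
  show ?case
  proof (cases "\<forall>A\<in>set b. true A")
    case True
    with tab_rule_cut_sound[OF extend.hyps(2)] obtain \<Delta>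
      where "\<Delta> \<in> set \<Delta>s" "\<forall>A\<in>set \<Delta>. true A" by blast
    with True have "b @ \<Delta> \<in> set (Bs @ map (\<lambda>\<Delta>. b @ \<Delta>) \<Delta>s @ Bs')" "\<forall>A\<in>set (b @ \<Delta>). true A"
      by auto
    then show ?thesis by blast
  next
    case False
    \<comment> \<open>The true branch is then not the extended one and survives unchanged.\<close>
    with extend.IH show ?thesis by auto
  qed
qed

lemma true_branch_open:
  assumes "\<And>A. A \<in> set b \<Longrightarrow> true A"
  shows "\<not> closed_branch CS b"
proof
  assume "closed_branch CS b"
  then consider A where "A \<in> set b" "Neg A \<in> set b" | "Bot \<in> set b"
    | c A where "Neg (Just (JConst c) A) \<in> set b" "Just (JConst c) A \<in> CS"
    unfolding closed_branch_def by blast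
  then show False
  proof cases
    case (1 A)
    then show False using assms[of A] assms[of "Neg A"] by simp
  next
    case 2
    then show False using assms[of Bot] by simp
  next
    case (3 c A)
    \<comment> \<open>Members of \<open>CS\<close> are subformulas of every formula, so \<Gamma>
      decides this one, and openness of \<Gamma> forces it to be true.\<close>
    have "subfm CS (Just (JConst c) A) R" by (rule subfm.cs[OF 3(2) subfm.refl])
    then have "true (Just (JConst c) A)"
      using saturated_CS[OF 3(2)] by (simp add: saturated_Neg_iff true_iff_mem)
    with assms[OF 3(1)] show False by simp
  qed
qed

end

theorem theorem6:
  fixes L :: "scheme set"
    and CS :: "('v, 'c, 'p::countable) fm set"
    and F :: "('v, 'c, 'p) fm"
  assumes "constant_spec L CS"
    and "fm_in L F"
    and "provable_cut L CS F"
  shows "provable L CS F"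
proof (rule ccontr)
  assume "\<not> provable L CS F"
  then have "\<not> refutable L CS (Neg F) {Neg F}"
    using refutable_provable by blast
  then obtain \<Gamma> where \<Gamma>: "{Neg F} \<subseteq> \<Gamma>" and sat: "saturated L CS (Neg F) \<Gamma>"
    by (rule ex_saturated)
  \<comment> \<open>The root is its own subformula and lies in \<Gamma>, so it is true and the
    true-branch invariant can start.\<close>
  have "truth {A. subfm CS A (Neg F)} \<Gamma> (Neg F)"
    using true_iff_mem[OF sat subfm.refl] \<Gamma> by blast
  moreover obtain T where "tableau (tab_rule_cut L CS) (Neg F) T" "closed_tableau CS T"
    using assms(3) unfolding provable_cut_def by blast
  ultimately show False
    using tableau_cut_true_branch[OF sat] true_branch_open[OF sat]
    unfolding closed_tableau_def by blast
qed

end
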